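(* For all sufficiently large $n$, \[ \frac{n}{12}\le wt(n)\le \frac{n}{2}-\Omega(n^{1/3}), \] i.e., every permutation of $[n]$ contains weak twins of length at least $n/12$, and there is a constant $c>0$ such that for all large $n$ there exists a permutation of $[n]$ containing no weak twins of length greater than $n/2-cn^{1/3}$.
   Context: A permutation is a finite sequence of distinct positive integers; an $n$-permutation is a permutation of $[n]=\{1,\dots,n\}$. The shape of a permutation $(x_1,\dots,x_w)$ is the sequence $(s_1,\dots,s_{w-1})\in\{+,-\}^{w-1}$ with $s_i=+$ iff $x_i<x_{i+1}$. Two permutations of the same length are weakly similar if they have the same shape. A sub-permutation of $\pi$ is a subsequence $(\pi(i_1),\dots,\pi(i_j))$ with $i_1<\dots<i_j$. Weak twins in $\pi$ are two disjoint (no common positions) weakly similar sub-permutations of $\pi$; their length is the length of one of them. $wt(\pi)$ is the largest $w$ such that $\pi$ contains weak twins of length $w$, and $wt(n)$ is the minimum of $wt(\pi)$ over all $n$-permutations $\pi$. *)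

theory Defs
  imports Complex_Main "HOL-Combinatorics.Multiset_Permutations"
begin

text \<open>
  Permutations are lists of natural numbers, so positions are counted from 0;
  the n-permutations are the elements of \<^term>\<open>permutations_of_set {1..n::nat}\<close>.
  In a shape, \<^term>\<open>True\<close> stands for the sign + and \<^term>\<open>False\<close> for the sign -.
\<close>

definition shape :: "nat list \<Rightarrow> bool list" where
  "shape xs = map (\<lambda>i. xs ! i < xs ! Suc i) [0..<length xs - 1]"

text \<open>The length condition is not redundant: lengths 0 and 1 both have the empty shape.\<close>

definition weakly_similar :: "nat list \<Rightarrow> nat list \<Rightarrow> bool" where
  "weakly_similar xs ys \<longleftrightarrow> length xs = length ys \<and> shape xs = shape ys"

text \<open>
  A sub-permutation is given by its set of positions \<open>I\<close>;
  the sequence itself is \<^term>\<open>nths p I\<close>.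
\<close>

definition weak_twins :: "nat list \<Rightarrow> nat set \<Rightarrow> nat set \<Rightarrow> bool" where
  "weak_twins p I J \<longleftrightarrow>
     I \<subseteq> {..<length p} \<and> J \<subseteq> {..<length p} \<and> I \<inter> J = {} \<and>
     weakly_similar (nths p I) (nths p J)"

definition has_weak_twins :: "nat list \<Rightarrow> nat \<Rightarrow> bool" where
  "has_weak_twins p w \<longleftrightarrow> (\<exists>I J. weak_twins p I J \<and> length (nths p I) = w)"

definition wt_perm :: "nat list \<Rightarrow> nat" where
  "wt_perm p = Max {w. has_weak_twins p w}"

definition wt :: "nat \<Rightarrow> nat" where
  "wt n = Min (wt_perm ` permutations_of_set {1..n})"

text \<open>The maximum and the minimum are taken over finite nonempty sets.\<close>

lemma has_weak_twins_0: "has_weak_twins p 0"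
  unfolding has_weak_twins_def weak_twins_def weakly_similar_def
  by (intro exI[of _ "{}"]) auto

lemma has_weak_twins_le_length: "has_weak_twins p w \<Longrightarrow> w \<le> length p"
proof -
  have "card {i. i < length p \<and> i \<in> I} \<le> card {..<length p}" for I
    by (rule card_mono) auto
  then show "has_weak_twins p w \<Longrightarrow> w \<le> length p"
    by (auto simp: has_weak_twins_def length_nths)
qed

lemma finite_has_weak_twins: "finite {w. has_weak_twins p w}"
  by (rule finite_subset[of _ "{..length p}"]) (auto dest: has_weak_twins_le_length)

lemma wt_perm_ge_iff: "w \<le> wt_perm p \<longleftrightarrow> (\<exists>v\<ge>w. has_weak_twins p v)"
  unfolding wt_perm_def using has_weak_twins_0
  by (subst Max_ge_iff[OF finite_has_weak_twins]) auto

lemma wt_perm_le_iff: "wt_perm p \<le> w \<longleftrightarrow> (\<forall>v. has_weak_twins p v \<longrightarrow> v \<le> w)"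
  unfolding wt_perm_def using has_weak_twins_0
  by (subst Max_le_iff[OF finite_has_weak_twins]) auto

lemma wt_ge_iff: "w \<le> wt n \<longleftrightarrow> (\<forall>p\<in>permutations_of_set {1..n}. w \<le> wt_perm p)"
  unfolding wt_def by (subst Min_ge_iff) auto

lemma wt_le_iff: "wt n \<le> w \<longleftrightarrow> (\<exists>p\<in>permutations_of_set {1..n}. wt_perm p \<le> w)"
  unfolding wt_def by (subst Min_le_iff) auto

end

theory Submission
  imports Defs
begin

text \<open>
  Lower bound. Let the first twin consist of the smaller and the second of the larger ends of a
  sequence of value intervals spanned by pairs from consecutive blocks of positions. The shapes
  agree as soon as no two consecutive intervals are nested. Keep two admissible choices for the
  last interval, with disjoint interiors: a new interval is then nested with both only if it
  contains both. Of the three consecutive intervals spanned by four new values at most one does, so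
  two with disjoint interiors survive. Hence every four positions extend the twins by one.

  Upper bound. Arrange increasing blocks such that every value of a block exceeds all values of the
  later blocks; a shape then records the sizes of the nonempty intersections with the blocks. If the
  \<open>k\<close>-th elements of both twins always lie in the same block, each block of odd length loses an
  element. Otherwise, at the first disagreement, one twin has to fit its part of a block into a
  later block while the other twin misses the former; with block lengths decreasing by at least
  \<open>m\<close> this costs \<open>m\<close> elements. Using \<open>m\<close> odd blocks with gaps \<open>2 * m\<close> takes about \<open>m ^ 3\<close> elements.
\<close>

subsection \<open>Lower bound\<close>

lemma shape_snoc: "shape (xs @ [x]) = (if xs = [] then [] else shape xs @ [last xs < x])"
proof (cases xs rule: rev_cases)
  case (snoc ys y)
  then show ?thesis
    by (auto simp: shape_def nth_append intro!: map_cong)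
qed (simp add: shape_def)

lemma nths_singleton_index: "i < length xs \<Longrightarrow> nths xs {i} = [xs ! i]"
proof (induction xs arbitrary: i)
  case (Cons x xs)
  then show ?case
    by (cases i) (simp_all add: nths_Cons)
qed simp

lemma nths_append_insert:
  assumes "I \<subseteq> {..<length xs}" "i < length ys"
  shows "nths (xs @ ys) (insert (length xs + i) I) = nths xs I @ [ys ! i]"
proof -
  have "nths xs (insert (length xs + i) I) = nths xs I"
    unfolding nths_def
    by (intro arg_cong[where f = "map fst"] filter_cong) (auto dest: set_zip_rightD)
  moreover have "{j. j + length xs \<in> insert (length xs + i) I} = {i}"
    using assms(1) by auto
  ultimately show ?thesis
    using assms(2) by (simp add: nths_append nths_singleton_index)
qed

lemma weak_twins_append_insert:
  assumes "weak_twins p I J" and "i < length r" "j < length r" "i \<noteq> j"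
    and "nths p I \<noteq> [] \<Longrightarrow> last (nths p I) < r ! i \<longleftrightarrow> last (nths p J) < r ! j"
  shows "weak_twins (p @ r) (insert (length p + i) I) (insert (length p + j) J)"
proof -
  have "I \<subseteq> {..<length p}" "J \<subseteq> {..<length p}"
    using assms(1) by (simp_all add: weak_twins_def)
  moreover have "nths p I = [] \<longleftrightarrow> nths p J = []"
    using assms(1) by (auto simp: weak_twins_def weakly_similar_def)
  ultimately show ?thesis
    using assms by (auto simp: weak_twins_def weakly_similar_def nths_append_insert shape_snoc)
qed

definition weak_twins_ending :: "nat list \<Rightarrow> nat \<Rightarrow> nat \<Rightarrow> nat \<Rightarrow> bool" where
  "weak_twins_ending p w x y \<longleftrightarrow>
     (\<exists>I J xs ys. weak_twins p I J \<and> length xs + 1 = w \<and>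
        nths p I = xs @ [x] \<and> nths p J = ys @ [y])"

lemma weak_twins_ending_imp_mem:
  assumes "weak_twins_ending p w x y"
  shows "x \<in> set p" "y \<in> set p"
proof -
  obtain I J xs ys where "nths p I = xs @ [x]" "nths p J = ys @ [y]"
    using assms by (auto simp: weak_twins_ending_def)
  then show "x \<in> set p" "y \<in> set p"
    using in_set_nthsD[of x p I] in_set_nthsD[of y p J] by simp_all
qed

lemma weak_twins_ending_imp_has_weak_twins: "weak_twins_ending p w x y \<Longrightarrow> has_weak_twins p w"
  by (auto simp: weak_twins_ending_def has_weak_twins_def)

lemma weak_twins_ending_1:
  assumes "x \<in> set p" "y \<in> set p" "x \<noteq> y"
  shows "weak_twins_ending p 1 x y"
proof -
  obtain i j where ij: "i < length p" "p ! i = x" "j < length p" "p ! j = y"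
    using assms(1,2) by (auto simp: in_set_conv_nth)
  then have "weak_twins p {i} {j}"
    using weak_twins_append_insert[of "[]" "{}" "{}" i p j] assms(3)
    by (auto simp: weak_twins_def weakly_similar_def)
  then show ?thesis
    unfolding weak_twins_ending_def using ij
    by (intro exI[of _ "{i}"] exI[of _ "{j}"] exI[of _ "[]"]) (simp add: nths_singleton_index)
qed

lemma weak_twins_ending_append:
  assumes "weak_twins_ending p w u v" and xy: "x \<in> set r" "y \<in> set r" "x \<noteq> y"
    and "u < x \<longleftrightarrow> v < y"
  shows "weak_twins_ending (p @ r) (Suc w) x y"
proof -
  obtain I J xs ys where twins: "weak_twins p I J" and w: "length xs + 1 = w"
    and ends: "nths p I = xs @ [u]" "nths p J = ys @ [v]"
    using assms(1) by (auto simp: weak_twins_ending_def)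
  obtain i j where ij: "i < length r" "r ! i = x" "j < length r" "r ! j = y"
    using xy by (auto simp: in_set_conv_nth)
  have "weak_twins (p @ r) (insert (length p + i) I) (insert (length p + j) J)"
    using weak_twins_append_insert[OF twins] ij xy(3) assms(5) ends by auto
  moreover have "nths (p @ r) (insert (length p + i) I) = (xs @ [u]) @ [x]"
    "nths (p @ r) (insert (length p + j) J) = (ys @ [v]) @ [y]"
    using twins ij ends by (simp_all add: nths_append_insert weak_twins_def)
  ultimately show ?thesis
    unfolding weak_twins_ending_def using w by (metis length_append_singleton Suc_eq_plus1)
qed

lemma not_nested_with_one_of_two:
  fixes u v u' v' x y :: "'a::linorder"
  assumes "u < v" "v \<le> u'" "u' < v'" "x < y" "x \<noteq> u" "\<not> (x < u \<and> v' < y)"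
  shows "(u < x \<longleftrightarrow> v < y) \<or> (u' < x \<longleftrightarrow> v' < y)"
proof (cases "u' < x \<or> v' < y")
  case True
  with assms have "u < x" "v < y"
    by auto
  then show ?thesis
    by simp
qed simp

lemma obtain_two_separated_intervals_not_containing:
  fixes a b c d u v :: "'a::linorder"
  assumes "a < b" "b < c" "c < d" "u \<le> v"
  obtains x y x' y' where "{x, y, x', y'} \<subseteq> {a, b, c, d}" "x < y" "y \<le> x'" "x' < y'"
    "\<not> (x < u \<and> v < y)" "\<not> (x' < u \<and> v < y')"
proof -
  consider (first) "v < b" | (middle) "b \<le> v" "v < c" | (last) "c \<le> v"
    by force
  then show thesis
  proof cases
    case first
    with assms show thesis by (intro that[of b c c d]) auto
  next
    case middle
    with assms show thesis by (intro that[of a b c d]) auto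
  next
    case last
    with assms show thesis by (intro that[of a b b c]) auto
  qed
qed

lemma obtain_four_increasing:
  fixes xs :: "'a::linorder list"
  assumes "distinct xs" "4 \<le> length xs"
  obtains a b c d where "{a, b, c, d} \<subseteq> set xs" "a < b" "b < c" "c < d"
proof -
  have "Suc (Suc (Suc (Suc 0))) \<le> length (sort xs)"
    using assms(2) by simp
  then obtain a b c d ys where sort: "sort xs = a # b # c # d # ys"
    unfolding Suc_le_length_iff by blast
  have "sorted_wrt (<) (sort xs)"
    using assms(1) by (simp add: strict_sorted_iff)
  then have "a < b" "b < c" "c < d"
    by (simp_all add: sort)
  moreover have "{a, b, c, d} \<subseteq> set (sort xs)"
    by (simp add: sort)
  ultimately show thesis
    by (intro that[of a b c d]) (simp_all only: set_sort)
qed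

definition separated_twin_ends :: "nat list \<Rightarrow> nat \<Rightarrow> bool" where
  "separated_twin_ends p w \<longleftrightarrow>
     (\<exists>u v u' v'. weak_twins_ending p w u v \<and> weak_twins_ending p w u' v' \<and>
        u < v \<and> v \<le> u' \<and> u' < v')"

lemma separated_twin_ends_1:
  assumes "distinct p" "4 \<le> length p"
  shows "separated_twin_ends p 1"
proof -
  obtain a b c d where "{a, b, c, d} \<subseteq> set p" "a < b" "b < c" "c < d"
    using obtain_four_increasing[OF assms] .
  moreover from this have "weak_twins_ending p 1 a b" "weak_twins_ending p 1 b c"
    by (auto intro!: weak_twins_ending_1 simp del: One_nat_def)
  ultimately show ?thesis
    unfolding separated_twin_ends_def by blast
qed

lemma separated_twin_ends_append:
  assumes "separated_twin_ends p w" "distinct (p @ r)" "4 \<le> length r"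
  shows "separated_twin_ends (p @ r) (Suc w)"
proof -
  obtain u v u' v' where uv: "weak_twins_ending p w u v" "weak_twins_ending p w u' v'"
    "u < v" "v \<le> u'" "u' < v'"
    using assms(1) by (auto simp: separated_twin_ends_def)
  have extend: "weak_twins_ending (p @ r) (Suc w) x y"
    if xy: "x \<in> set r" "y \<in> set r" "x < y" and not_containing: "\<not> (x < u \<and> v' < y)" for x y
  proof -
    have "x \<noteq> u"
      using weak_twins_ending_imp_mem(1)[OF uv(1)] assms(2) xy(1) by auto
    from not_nested_with_one_of_two[OF uv(3-5) xy(3) this not_containing]
    show ?thesis
      using uv(1,2)[THEN weak_twins_ending_append, of x r y] xy by auto
  qed
  have "distinct r"
    using assms(2) by simp
  then obtain a b c d where abcd: "{a, b, c, d} \<subseteq> set r" "a < b" "b < c" "c < d"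
    using obtain_four_increasing assms(3) by blast
  have "u \<le> v'"
    using uv(3-5) by simp
  obtain x y x' y' where mem: "{x, y, x', y'} \<subseteq> {a, b, c, d}"
    and less: "x < y" "y \<le> x'" "x' < y'"
    and not_containing: "\<not> (x < u \<and> v' < y)" "\<not> (x' < u \<and> v' < y')"
    using obtain_two_separated_intervals_not_containing[OF abcd(2-4) \<open>u \<le> v'\<close>] .
  have "{x, y, x', y'} \<subseteq> set r"
    using mem abcd(1) by (rule subset_trans)
  then have "weak_twins_ending (p @ r) (Suc w) x y" "weak_twins_ending (p @ r) (Suc w) x' y'"
    using less not_containing by (simp_all add: extend)
  with less show ?thesis
    unfolding separated_twin_ends_def by blast
qed

lemma separated_twin_ends_of_length:
  assumes "distinct p" "4 * Suc k \<le> length p"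
  shows "separated_twin_ends p (Suc k)"
  using assms
proof (induction k arbitrary: p)
  case 0
  then show ?case
    using separated_twin_ends_1 by simp
next
  case (Suc k)
  let ?q = "take (4 * Suc k) p" and ?r = "drop (4 * Suc k) p"
  have "separated_twin_ends ?q (Suc k)"
    using Suc.prems by (intro Suc.IH) auto
  then have "separated_twin_ends (?q @ ?r) (Suc (Suc k))"
    using Suc.prems by (intro separated_twin_ends_append) auto
  then show ?case
    by simp
qed

lemma has_weak_twins_div_4:
  assumes "distinct p"
  shows "has_weak_twins p (length p div 4)"
proof (cases "length p div 4")
  case (Suc k)
  then have "separated_twin_ends p (Suc k)"
    using assms by (intro separated_twin_ends_of_length) auto
  then show ?thesis
    unfolding Suc separated_twin_ends_def using weak_twins_ending_imp_has_weak_twins by blast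
qed (simp add: has_weak_twins_0)

lemma wt_ge_div_4: "n div 4 \<le> wt n"
  unfolding wt_ge_iff
proof
  fix p assume "p \<in> permutations_of_set {1..n}"
  then have "distinct p" "length p = n"
    by (simp_all add: permutations_of_setD length_finite_permutations_of_set)
  then show "n div 4 \<le> wt_perm p"
    using has_weak_twins_div_4 wt_perm_ge_iff by blast
qed

subsection \<open>Upper bound\<close>

lemma sorted_wrt_nths: "sorted_wrt R xs \<Longrightarrow> sorted_wrt R (nths xs I)"
  by (induction xs arbitrary: I) (auto simp: nths_Cons dest: in_set_nthsD)

lemma count_list_nths_disjoint:
  "I \<inter> J = {} \<Longrightarrow> count_list (nths xs I) x + count_list (nths xs J) x \<le> count_list xs x"
proof (induction xs arbitrary: I J)
  case (Cons y xs)
  have "{j. Suc j \<in> I} \<inter> {j. Suc j \<in> J} = {}"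
    using Cons.prems by auto
  from Cons.IH[OF this] show ?case
    using Cons.prems by (auto simp: nths_Cons)
qed simp

definition same_kernel :: "'a list \<Rightarrow> 'b list \<Rightarrow> bool" where
  "same_kernel xs ys \<longleftrightarrow> length xs = length ys \<and>
     (\<forall>k<length xs. \<forall>l<length xs. xs ! k = xs ! l \<longleftrightarrow> ys ! k = ys ! l)"

lemma same_kernel_sym: "same_kernel xs ys \<Longrightarrow> same_kernel ys xs"
  by (simp add: same_kernel_def)

lemma count_list_same_kernel:
  assumes "same_kernel xs ys" "k < length xs"
  shows "count_list xs (xs ! k) = count_list ys (ys ! k)"
proof -
  have "{l. l < length xs \<and> xs ! k = xs ! l} = {l. l < length ys \<and> ys ! k = ys ! l}"
    using assms by (auto simp: same_kernel_def)
  then show ?thesis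
    by (simp add: count_list_eq_length_filter length_filter_conv_card)
qed

lemma sorted_nth_eq_iff_adjacent_eq:
  fixes xs :: "'a::linorder list"
  assumes "sorted xs" "k \<le> l" "l < length xs"
  shows "xs ! k = xs ! l \<longleftrightarrow> (\<forall>i\<in>{k..<l}. xs ! i = xs ! Suc i)"
  using assms(2,3)
proof (induction l rule: dec_induct)
  case (step l)
  have "xs ! k \<le> xs ! l" "xs ! l \<le> xs ! Suc l"
    using assms(1) step.hyps step.prems by (auto intro: sorted_nth_mono)
  then have "xs ! k = xs ! Suc l \<longleftrightarrow> xs ! k = xs ! l \<and> xs ! l = xs ! Suc l"
    by auto
  moreover have "{k..<Suc l} = insert l {k..<l}"
    using step.hyps(1) by auto
  ultimately show ?case
    using step.IH step.prems by auto
qed simp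

lemma same_kernel_sortedI:
  fixes xs :: "'a::linorder list" and ys :: "'b::linorder list"
  assumes "sorted xs" "sorted ys" "length xs = length ys"
    and adjacent: "\<And>k. Suc k < length xs \<Longrightarrow> xs ! k = xs ! Suc k \<longleftrightarrow> ys ! k = ys ! Suc k"
  shows "same_kernel xs ys"
proof -
  have "xs ! k = xs ! l \<longleftrightarrow> ys ! k = ys ! l" if "k \<le> l" "l < length xs" for k l
  proof -
    have "(\<forall>i\<in>{k..<l}. xs ! i = xs ! Suc i) \<longleftrightarrow> (\<forall>i\<in>{k..<l}. ys ! i = ys ! Suc i)"
      using adjacent that by (intro ball_cong) auto
    then show ?thesis
      using that assms(1-3) by (simp only: sorted_nth_eq_iff_adjacent_eq)
  qed
  then show ?thesis
    unfolding same_kernel_def using assms(3) by (metis nle_le)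
qed

lemma same_kernel_nth_notin:
  fixes xs ys :: "'a::linorder list"
  assumes "same_kernel xs ys" "sorted ys" "k < length xs"
    and "\<And>l. l < k \<Longrightarrow> xs ! l = ys ! l" and "xs ! k < ys ! k"
  shows "xs ! k \<notin> set ys"
proof
  assume "xs ! k \<in> set ys"
  then obtain l where l: "l < length ys" "ys ! l = xs ! k"
    by (auto simp: in_set_conv_nth)
  show False
  proof (cases "l < k")
    case True
    then have "xs ! l = xs ! k"
      using assms(4) l(2) by simp
    then have "ys ! l = ys ! k"
      using assms(1,3) True by (auto simp: same_kernel_def)
    then show False
      using l(2) assms(5) by simp
  next
    case False
    then have "ys ! k \<le> ys ! l"
      using assms(2) l(1) by (simp add: sorted_nth_mono)
    then show False
      using l(2) assms(5) by simp
  qed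
qed

lemma count_list_deficit_of_less:
  fixes xs ys :: "'a::linorder list" and L :: "'a \<Rightarrow> nat"
  assumes "same_kernel xs ys" "sorted ys" "k < length xs"
    and "\<And>l. l < k \<Longrightarrow> xs ! l = ys ! l" and "xs ! k < ys ! k"
    and "count_list ys (ys ! k) \<le> L (ys ! k)" "L (ys ! k) + d \<le> L (xs ! k)"
  shows "count_list xs (xs ! k) + count_list ys (xs ! k) + d \<le> L (xs ! k)"
proof -
  have "count_list ys (xs ! k) = 0"
    using same_kernel_nth_notin[OF assms(1-5)] by simp
  moreover have "count_list xs (xs ! k) \<le> L (ys ! k)"
    using count_list_same_kernel[OF assms(1,3)] assms(6) by simp
  ultimately show ?thesis
    using assms(7) by simp
qed

lemma obtain_first_difference:
  assumes "length xs = length ys" "xs \<noteq> ys"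
  obtains k where "k < length xs" "xs ! k \<noteq> ys ! k" "\<And>l. l < k \<Longrightarrow> xs ! l = ys ! l"
proof -
  have "\<exists>k. k < length xs \<and> xs ! k \<noteq> ys ! k"
    using assms nth_equalityI by blast
  then obtain k where k: "k < length xs" "xs ! k \<noteq> ys ! k"
    and least: "\<And>l. l < k \<Longrightarrow> \<not> (l < length xs \<and> xs ! l \<noteq> ys ! l)"
    using exists_least_iff[of "\<lambda>k. k < length xs \<and> xs ! k \<noteq> ys ! k"] by blast
  have "xs ! l = ys ! l" if "l < k" for l
    using least[OF that] that k(1) by simp
  with k show thesis
    by (rule that)
qed

lemma count_list_deficit:
  fixes xs ys :: "'a::linorder list" and L :: "'a \<Rightarrow> nat"
  assumes kernel: "same_kernel xs ys" and sorted: "sorted xs" "sorted ys" and "xs \<noteq> ys"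
    and range: "set xs \<subseteq> B" "set ys \<subseteq> B"
    and counts: "\<And>b. b \<in> B \<Longrightarrow> count_list xs b + count_list ys b \<le> L b"
    and gap: "\<And>b b'. b \<in> B \<Longrightarrow> b' \<in> B \<Longrightarrow> b < b' \<Longrightarrow> L b' + d \<le> L b"
  obtains b where "b \<in> B" "count_list xs b + count_list ys b + d \<le> L b"
proof -
  have len: "length xs = length ys"
    using kernel by (simp add: same_kernel_def)
  obtain k where k: "k < length xs" "xs ! k \<noteq> ys ! k" "\<And>l. l < k \<Longrightarrow> xs ! l = ys ! l"
    using obtain_first_difference[OF len \<open>xs \<noteq> ys\<close>] by blast
  have mem: "xs ! k \<in> B" "ys ! k \<in> B"
    using range k(1) len by auto
  consider (less) "xs ! k < ys ! k" | (greater) "ys ! k < xs ! k"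
    using k(2) by force
  then show thesis
  proof cases
    case less
    have "count_list xs (xs ! k) + count_list ys (xs ! k) + d \<le> L (xs ! k)"
      using counts[OF mem(2)] gap[OF mem less] k(1,3)
      by (intro count_list_deficit_of_less kernel sorted less) auto
    with mem(1) show thesis
      by (rule that)
  next
    case greater
    have "count_list ys (ys ! k) + count_list xs (ys ! k) + d \<le> L (ys ! k)"
      using counts[OF mem(1)] gap[OF mem(2,1) greater] k(1,3) len
      by (intro count_list_deficit_of_less same_kernel_sym[OF kernel] sorted greater) auto
    with mem(2) show thesis
      by (intro that[of "ys ! k"]) auto
  qed
qed

lemma double_sum_add_card_odd_le:
  fixes f L :: "'a \<Rightarrow> nat"
  assumes "finite B" "\<And>b. b \<in> B \<Longrightarrow> 2 * f b \<le> L b"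
  shows "2 * sum f B + card {b \<in> B. odd (L b)} \<le> sum L B"
proof -
  have "2 * f b + of_bool (odd (L b)) \<le> L b" if "b \<in> B" for b
    using assms(2)[OF that] by (cases "even (L b)") (auto elim!: oddE)
  then have "(\<Sum>b\<in>B. 2 * f b + of_bool (odd (L b))) \<le> sum L B"
    by (rule sum_mono)
  then show ?thesis
    using assms(1) by (simp add: sum.distrib sum_distrib_left Collect_conj_eq)
qed

lemma length_add_length_le_of_same_kernel:
  fixes xs ys :: "'a::linorder list" and L :: "'a \<Rightarrow> nat"
  assumes kernel: "same_kernel xs ys" and sorted: "sorted xs" "sorted ys"
    and range: "set xs \<subseteq> B" "set ys \<subseteq> B" and "finite B"
    and counts: "\<And>b. b \<in> B \<Longrightarrow> count_list xs b + count_list ys b \<le> L b"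
    and gap: "\<And>b b'. b \<in> B \<Longrightarrow> b' \<in> B \<Longrightarrow> b < b' \<Longrightarrow> L b' + d \<le> L b"
    and odd: "d \<le> card {b \<in> B. odd (L b)}"
  shows "length xs + length ys + d \<le> sum L B"
proof (cases "xs = ys")
  case True
  then have "2 * sum (count_list ys) B + card {b \<in> B. odd (L b)} \<le> sum L B"
    using counts by (intro double_sum_add_card_odd_le \<open>finite B\<close>) fastforce
  then show ?thesis
    using True odd sum_count_set[OF range(2) \<open>finite B\<close>] by simp
next
  case False
  obtain b where b: "b \<in> B" "count_list xs b + count_list ys b + d \<le> L b"
    using count_list_deficit[OF kernel sorted False range counts gap] .
  have "length xs + length ys = (\<Sum>b\<in>B. count_list xs b + count_list ys b)"
    using range \<open>finite B\<close> by (simp add: sum.distrib sum_count_set)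
  moreover have "(\<Sum>b\<in>B - {b}. count_list xs b + count_list ys b) \<le> sum L (B - {b})"
    using counts by (intro sum_mono) auto
  ultimately show ?thesis
    using b by (simp add: sum.remove[OF \<open>finite B\<close>])
qed

definition descending_blocks :: "(nat \<Rightarrow> 'a::linorder) \<Rightarrow> nat list \<Rightarrow> bool" where
  "descending_blocks blk =
     sorted_wrt (\<lambda>x y. blk x \<le> blk y \<and> (x < y \<longleftrightarrow> blk x = blk y))"

lemma sorted_map_descending_blocks: "descending_blocks blk xs \<Longrightarrow> sorted (map blk xs)"
  unfolding descending_blocks_def sorted_map by (erule sorted_wrt_mono_rel[rotated]) simp

lemma shape_nth_descending_blocks:
  assumes "descending_blocks blk xs" "Suc k < length xs"
  shows "shape xs ! k \<longleftrightarrow> blk (xs ! k) = blk (xs ! Suc k)"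
proof -
  have "xs ! k < xs ! Suc k \<longleftrightarrow> blk (xs ! k) = blk (xs ! Suc k)"
    using assms sorted_wrt_nth_less[of _ xs k "Suc k"] by (auto simp: descending_blocks_def)
  moreover have "k < length xs - 1"
    using assms(2) by simp
  ultimately show ?thesis
    by (simp add: shape_def)
qed

lemma same_kernel_weakly_similar:
  assumes "descending_blocks blk xs" "descending_blocks blk ys" "weakly_similar xs ys"
  shows "same_kernel (map blk xs) (map blk ys)"
proof -
  have "length (map blk xs) = length (map blk ys)"
    using assms(3) by (simp add: weakly_similar_def)
  moreover have "map blk xs ! k = map blk xs ! Suc k \<longleftrightarrow> map blk ys ! k = map blk ys ! Suc k"
    if "Suc k < length (map blk xs)" for k
    using that assms(3) shape_nth_descending_blocks[OF assms(1), of k]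
      shape_nth_descending_blocks[OF assms(2), of k]
    by (simp add: weakly_similar_def)
  ultimately show ?thesis
    by (rule same_kernel_sortedI[OF assms(1,2)[THEN sorted_map_descending_blocks]])
qed

lemma has_weak_twins_descending_blocks:
  assumes blocks: "descending_blocks blk p" and "has_weak_twins p w"
    and B: "blk ` set p \<subseteq> B" "finite B"
    and gap: "\<And>b b'. b \<in> B \<Longrightarrow> b' \<in> B \<Longrightarrow> b < b' \<Longrightarrow>
      count_list (map blk p) b' + d \<le> count_list (map blk p) b"
    and odd: "d \<le> card {b \<in> B. odd (count_list (map blk p) b)}"
  shows "2 * w + d \<le> length p"
proof -
  obtain I J where "I \<inter> J = {}" and similar: "weakly_similar (nths p I) (nths p J)"
    and w: "length (nths p I) = w"
    using assms(2) by (auto simp: has_weak_twins_def weak_twins_def)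
  have sub: "descending_blocks blk (nths p K)" for K
    using blocks by (simp add: descending_blocks_def sorted_wrt_nths)
  have range: "set (map blk (nths p K)) \<subseteq> B" for K
    using B(1) set_nths_subset[of p K] by auto
  have counts: "count_list (map blk (nths p I)) b + count_list (map blk (nths p J)) b
      \<le> count_list (map blk p) b" for b
    using count_list_nths_disjoint[OF \<open>I \<inter> J = {}\<close>, of "map blk p"] by (simp add: nths_map)
  have "length (map blk (nths p I)) + length (map blk (nths p J)) + d
      \<le> (\<Sum>b\<in>B. count_list (map blk p) b)"
    by (rule length_add_length_le_of_same_kernel[OF same_kernel_weakly_similar[OF sub sub similar]
          sub[THEN sorted_map_descending_blocks] sub[THEN sorted_map_descending_blocks]
          range range B(2) counts gap odd])
  also have "\<dots> = length p"
    using B sum_count_set[of "map blk p" B] by simp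
  finally show ?thesis
    using similar w by (simp add: weakly_similar_def)
qed

primrec block_perm :: "nat list \<Rightarrow> nat list" where
  "block_perm [] = []"
| "block_perm (L # Ls) = [Suc (sum_list Ls)..<Suc (sum_list Ls + L)] @ block_perm Ls"

primrec block_index :: "nat list \<Rightarrow> nat \<Rightarrow> nat" where
  "block_index [] x = 0"
| "block_index (L # Ls) x = (if x \<le> sum_list Ls then Suc (block_index Ls x) else 0)"

lemma set_block_perm: "set (block_perm Ls) = {1..sum_list Ls}"
proof (induction Ls)
  case (Cons L Ls)
  have "set (block_perm (L # Ls)) =
      {Suc (sum_list Ls)..<Suc (sum_list Ls + L)} \<union> {1..sum_list Ls}"
    using Cons.IH by (simp del: upt_Suc)
  also have "\<dots> = {1..sum_list (L # Ls)}"
    by auto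
  finally show ?case .
qed simp

lemma block_perm_in_permutations: "block_perm Ls \<in> permutations_of_set {1..sum_list Ls}"
proof -
  have "distinct (block_perm Ls)"
    by (induction Ls) (auto simp: set_block_perm)
  then show ?thesis
    by (simp add: permutations_of_setI set_block_perm)
qed

lemma map_block_index_Cons:
  "map (block_index (L # Ls)) (block_perm (L # Ls)) =
     replicate L 0 @ map Suc (map (block_index Ls) (block_perm Ls))"
proof -
  have "map (block_index (L # Ls)) [Suc (sum_list Ls)..<Suc (sum_list Ls + L)] = replicate L 0"
    by (rule replicate_eqI) auto
  moreover have "map (block_index (L # Ls)) (block_perm Ls) =
      map Suc (map (block_index Ls) (block_perm Ls))"
    by (simp add: set_block_perm)
  ultimately show ?thesis
    by (simp del: block_index.simps)
qed

lemma block_index_less_length: "x \<in> {1..sum_list Ls} \<Longrightarrow> block_index Ls x < length Ls"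
  by (induction Ls) auto

lemma count_list_block_index:
  "b < length Ls \<Longrightarrow> count_list (map (block_index Ls) (block_perm Ls)) b = Ls ! b"
proof (induction Ls arbitrary: b)
  case (Cons L Ls)
  have replicate: "count_list (replicate L 0) b = (if b = 0 then L else 0)"
    by (simp add: count_list_eq_length_filter)
  show ?case
  proof (cases b)
    case 0
    then show ?thesis
      unfolding map_block_index_Cons using replicate by (auto simp: count_list_0_iff)
  next
    case (Suc b')
    then show ?thesis
      unfolding map_block_index_Cons using Cons replicate
      by (simp add: count_list_map_conv del: map_map)
  qed
qed simp

lemma descending_blocks_block_perm: "descending_blocks (block_index Ls) (block_perm Ls)"
proof (induction Ls)
  case (Cons L Ls)
  have "descending_blocks (block_index (L # Ls)) [Suc (sum_list Ls)..<Suc (sum_list Ls + L)]"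
    unfolding descending_blocks_def by (rule sorted_wrt_mono_rel[OF _ sorted_wrt_upt]) auto
  moreover have "descending_blocks (block_index (L # Ls)) (block_perm Ls)"
    using Cons.IH unfolding descending_blocks_def
    by (rule sorted_wrt_mono_rel[rotated]) (auto simp: set_block_perm)
  ultimately show ?case
    by (auto simp: descending_blocks_def sorted_wrt_append set_block_perm)
qed (simp add: descending_blocks_def)

lemma wt_sum_list_le:
  assumes gap: "sorted_wrt (\<lambda>x y. y + d \<le> x) Ls" and odd: "d \<le> length (filter odd Ls)"
  shows "2 * wt (sum_list Ls) + d \<le> sum_list Ls"
proof -
  let ?p = "block_perm Ls"
  have len: "length ?p = sum_list Ls"
    using length_finite_permutations_of_set[OF block_perm_in_permutations] by simp
  have bound: "2 * w + d \<le> sum_list Ls" if "has_weak_twins ?p w" for w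
    unfolding len[symmetric]
  proof (rule has_weak_twins_descending_blocks[OF descending_blocks_block_perm that])
    show "block_index Ls ` set ?p \<subseteq> {..<length Ls}"
      unfolding set_block_perm using block_index_less_length by auto
    show "d \<le> card {b \<in> {..<length Ls}. odd (count_list (map (block_index Ls) ?p) b)}"
      using odd by (simp add: count_list_block_index length_filter_conv_card cong: conj_cong)
  qed (use sorted_wrt_nth_less[OF gap] in \<open>auto simp: count_list_block_index\<close>)
  have "wt_perm ?p \<le> (sum_list Ls - d) div 2"
    unfolding wt_perm_le_iff using bound by fastforce
  then have "wt (sum_list Ls) \<le> (sum_list Ls - d) div 2"
    unfolding wt_le_iff using block_perm_in_permutations by blast
  moreover have "d \<le> sum_list Ls"
    using bound[OF has_weak_twins_0] by simp
  ultimately show ?thesis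
    by linarith
qed

primrec odd_block_sizes :: "nat \<Rightarrow> nat \<Rightarrow> nat list" where
  "odd_block_sizes d 0 = []"
| "odd_block_sizes d (Suc k) = (2 * d * k + 1) # odd_block_sizes d k"

lemma length_filter_odd_block_sizes: "length (filter odd (odd_block_sizes d k)) = k"
  by (induction k) simp_all

lemma sum_list_odd_block_sizes: "sum_list (odd_block_sizes d k) + d * k = d * k ^ 2 + k"
  by (induction k) (simp_all add: power2_eq_square algebra_simps)

lemma odd_block_sizes_le: "x \<in> set (odd_block_sizes d k) \<Longrightarrow> x + 2 * d \<le> 2 * d * k + 1"
  by (induction k) auto

lemma sorted_wrt_odd_block_sizes: "sorted_wrt (\<lambda>x y. y + d \<le> x) (odd_block_sizes d k)"
  by (induction k) (use odd_block_sizes_le in fastforce)+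

lemma wt_le_of_cube_le:
  assumes "3 * m ^ 3 \<le> n"
  shows "2 * wt n + m \<le> n"
proof -
  define Ls where "Ls = odd_block_sizes m m"
  define rest where "rest = n - sum_list Ls"
  have powers: "m \<le> m ^ 3" "m ^ 2 \<le> m ^ 3"
    by (cases "m = 0"; simp add: self_le_power power_increasing)+
  have sum_Ls: "sum_list Ls + m ^ 2 = m ^ 3 + m"
    using sum_list_odd_block_sizes[of m m]
    by (simp add: Ls_def power2_eq_square power3_eq_cube)
  then have sum: "sum_list (rest # Ls) = n"
    using powers assms by (simp add: rest_def)
  have "x + m \<le> rest" if "x \<in> set Ls" for x
  proof -
    have "0 < m"
      using that by (cases m) (simp_all add: Ls_def)
    then have "1 \<le> m ^ 3"
      by simp
    moreover have "x + 2 * m \<le> 2 * m ^ 2 + 1"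
      using odd_block_sizes_le[of x m m] that by (simp add: Ls_def power2_eq_square)
    ultimately show ?thesis
      using sum_Ls powers assms unfolding rest_def by linarith
  qed
  then have "sorted_wrt (\<lambda>x y. y + m \<le> x) (rest # Ls)"
    by (simp add: Ls_def sorted_wrt_odd_block_sizes)
  moreover have "m \<le> length (filter odd (rest # Ls))"
    using length_filter_odd_block_sizes[of m m] by (simp add: Ls_def)
  ultimately show ?thesis
    using wt_sum_list_le[of m "rest # Ls"] unfolding sum by simp
qed

lemma wt_le_cube_root:
  assumes "64 \<le> n"
  shows "real (wt n) \<le> real n / 2 - 1/8 * real n powr (1/3)"
proof -
  define r where "r = real n powr (1/3)"
  have cube: "r ^ 3 = real n"
    using assms root_powr_inverse[of 3 "real n"] real_root_pow_pos2[of 3 "real n"]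
    by (simp add: r_def)
  have "4 \<le> r"
  proof (rule power_le_imp_le_base)
    show "4 ^ Suc 2 \<le> r ^ Suc 2"
      using assms cube by simp
  qed (simp add: r_def)
  define m where "m = nat \<lfloor>r / 2\<rfloor>"
  have m: "real m \<le> r / 2" "r / 2 < real m + 1"
    using \<open>4 \<le> r\<close> of_nat_floor[of "r / 2"] by (simp_all add: m_def)
  have "real m ^ 3 \<le> (r / 2) ^ 3"
    using m(1) by (intro power_mono) auto
  then have "real (3 * m ^ 3) \<le> real n"
    using cube by (simp add: power_divide)
  then have "2 * wt n + m \<le> n"
    by (intro wt_le_of_cube_le) linarith
  then have "2 * real (wt n) + real m \<le> real n"
    by linarith
  then show ?thesis
    using m(2) \<open>4 \<le> r\<close> by (fold r_def) linarith
qed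

theorem theorem1:
  shows "\<exists>c::real. c > 0 \<and>
    (\<forall>\<^sub>F n in sequentially.
       real n / 12 \<le> real (wt n) \<and>
       real (wt n) \<le> real n / 2 - c * real n powr (1/3))"
proof (intro exI[of _ "1/8"] conjI eventually_sequentiallyI[of 64])
  fix n :: nat assume n: "64 \<le> n"
  have "n \<le> 12 * (n div 4)"
    using n by linarith
  with wt_ge_div_4[of n] show "real n / 12 \<le> real (wt n)"
    by linarith
  show "real (wt n) \<le> real n / 2 - 1/8 * real n powr (1/3)"
    using n by (rule wt_le_cube_root)
qed simp

end
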